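(* Consider the linear system $\dot x = Ax+Bu$, $y=Cx$, with $A\in\mathbb{R}^{n\times n}$, $B\in\mathbb{R}^{n\times 1}$, $C\in\mathbb{R}^{1\times n}$, $(A,B,C)$ minimal and $\sigma(A)\subset\mathbb{C}^{-}$, fed by the signal generator $\dot\omega=S\omega$, $\theta=L\omega$, $\omega(0)\neq 0$, with $S\in\mathbb{R}^{\nu\times\nu}$, $L\in\mathbb{R}^{1\times\nu}$, $\nu\le n$, and the realization $(L,S,\omega(0))$ minimal, i.e. $u(t)=\theta(t)$. Assume that the output $\theta(t)$ is a persistent signal ($\sigma(S)\subset\mathbb{C}^{0}$) and that $\sigma(A)\cap\sigma(S)=\emptyset$. Let $\epsilon(t)=y(t)-\theta(t)$. Then $\lim_{t\to\infty}\epsilon(t)=0$ if and only if $$L=C\Pi,$$ where $\Pi$ is the unique solution of the Sylvester equation $A\Pi+BL=\Pi S$.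
   Context: $\sigma(M)$ is the set of eigenvalues of $M$; $\mathbb{C}^{-}$ is the set of complex numbers with negative real part; $\mathbb{C}^{0}$ is the set of complex numbers with zero real part. $(A,B,C)$ minimal means controllable and observable. The triplet $(L,S,\omega(0))$ minimal means that $(L,S)$ is observable and $(S,\omega(0))$ is reachable, i.e. $\omega(0),S\omega(0),\dots,S^{\nu-1}\omega(0)$ span the whole state space of the generator. The initial state $x(0)$ is arbitrary. *)

theory Defs
  imports "HOL-Analysis.Analysis"
begin

definition eigenvalues :: "real^'n^'n \<Rightarrow> complex set" where
  "eigenvalues M = {\<mu>. \<exists>v::complex^'n. v \<noteq> 0 \<and> map_matrix complex_of_real M *v v = \<mu> *s v}"

definition open_left_half_plane :: "complex set" where
  "open_left_half_plane = {z. Re z < 0}"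

definition imaginary_axis :: "complex set" where
  "imaginary_axis = {z. Re z = 0}"

(* Full rank of the controllability matrix [B, AB, ..., A^(n-1) B]. *)
definition controllable :: "real^'n^'n \<Rightarrow> real^'m^'n \<Rightarrow> bool" where
  "controllable A B \<longleftrightarrow>
     span (\<Union>k<CARD('n). columns (((\<lambda>X. A ** X) ^^ k) B)) = UNIV"

(* Full rank of the observability matrix with block rows C, CA, ..., C A^(n-1). *)
definition observable :: "real^'n^'p \<Rightarrow> real^'n^'n \<Rightarrow> bool" where
  "observable C A \<longleftrightarrow>
     span (\<Union>k<CARD('n). rows (((\<lambda>X. X ** A) ^^ k) C)) = UNIV"

definition reachable :: "real^'n^'n \<Rightarrow> real^'n \<Rightarrow> bool" where
  "reachable S w \<longleftrightarrow> span ((\<lambda>k. (((*v) S) ^^ k) w) ` {..<CARD('n)}) = UNIV"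

definition minimal_system :: "real^'n^'n \<Rightarrow> real^'m^'n \<Rightarrow> real^'n^'p \<Rightarrow> bool" where
  "minimal_system A B C \<longleftrightarrow> controllable A B \<and> observable C A"

definition minimal_generator :: "real^'n^'p \<Rightarrow> real^'n^'n \<Rightarrow> real^'n \<Rightarrow> bool" where
  "minimal_generator L S w0 \<longleftrightarrow> observable L S \<and> reachable S w0"

(* Trajectories live on the time axis [0, \<infinity>); the derivative at 0 is one-sided and the
   values of the signals at negative times are irrelevant. *)
definition system_trajectory ::
  "real^'n^'n \<Rightarrow> real^'m^'n \<Rightarrow> real^'n^'p \<Rightarrow>
   (real \<Rightarrow> real^'m) \<Rightarrow> (real \<Rightarrow> real^'n) \<Rightarrow> (real \<Rightarrow> real^'p) \<Rightarrow> bool" where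
  "system_trajectory A B C u x y \<longleftrightarrow>
     (\<forall>t\<ge>0. (x has_vector_derivative (A *v x t + B *v u t)) (at t within {0..}) \<and>
            y t = C *v x t)"

definition generator_trajectory ::
  "real^'n^'n \<Rightarrow> real^'n^'p \<Rightarrow> (real \<Rightarrow> real^'n) \<Rightarrow> (real \<Rightarrow> real^'p) \<Rightarrow> bool" where
  "generator_trajectory S L w \<theta> \<longleftrightarrow>
     (\<forall>t\<ge>0. (w has_vector_derivative (S *v w t)) (at t within {0..}) \<and> \<theta> t = L *v w t)"

end

theory Submission
  imports Defs "HOL-Computational_Algebra.Fundamental_Theorem_Algebra"
begin

text \<open>
  Why the theorem holds. If \<open>P\<close> solves the Sylvester equation, then the deviation
  \<open>z = x - P w\<close> obeys the undriven equation \<open>z' = A z\<close>, so it dies out because \<open>A\<close> is stable.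
  Since \<open>\<epsilon> = C z + (C P - L) w\<close>, the error vanishes in the limit exactly when the signal
  \<open>(C P - L) w\<close> does. All modes of \<open>S\<close> lie on the imaginary axis, and a signal built from such
  modes cannot tend to zero unless it is zero throughout. A row vector whose product with \<open>w\<close>
  is identically zero also annihilates all derivatives \<open>S\<^sup>k w(0)\<close>, and these span the state space
  by reachability. So the row vector \<open>C P - L\<close> is zero.

  Spectral information enters in only one form (\<open>ex_eigenvalues_factor_prod_eq_0\<close>): some finite
  product of factors \<open>A - a\<close>, each \<open>a\<close> an eigenvalue of \<open>A\<close>, is the zero matrix. This replaces
  the Jordan form, the Cayley-Hamilton theorem and the matrix exponential:

  \<^item> For the Sylvester equation (\<open>sylvester_ex1\<close>), \<open>A X = X S\<close> lets \<open>X\<close> intertwine the product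
    for \<open>S\<close> with the same product formed from \<open>A\<close>. The former is zero, the latter is
    injective when the spectra are disjoint, hence \<open>X = 0\<close>; in finite dimension uniqueness gives
    existence.
  \<^item> Every scalar component \<open>f\<close> of a trajectory of \<open>z' = A z\<close> satisfies the scalar equation
    \<open>(d/dt - a\<^sub>1) ... (d/dt - a\<^sub>m) f = 0\<close> (\<open>factored_signal\<close>).
  \<^item> If all \<open>a\<^sub>i\<close> have negative real part, peeling off one first-order equation at a time shows
    \<open>f \<longlongrightarrow> 0\<close> (\<open>solves_factored_tendsto_0\<close>).
  \<^item> If all \<open>a\<^sub>i\<close> are imaginary and \<open>f \<longlongrightarrow> 0\<close>, then \<open>f = 0\<close>
    (\<open>solves_factored_imaginary_tendsto_0_imp\<close>): the difference \<open>f(t + h) - exp(a\<^sub>m h) f(t)\<close>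
    tends to zero as well and solves the equation with the factor \<open>a\<^sub>m\<close> removed, so by induction it
    is zero. Then \<open>\<bar>f\<bar>\<close> is constant with limit zero.
\<close>

section \<open>Annihilating products of eigenvalue factors\<close>

lemma mat_add: "mat (a + b) = (mat a + mat b :: 'a::comm_ring_1^'n^'n)"
  by (simp add: vec_eq_iff mat_def)

lemma mat_matrix_mult_nth: "(mat a ** X) $ i $ j = a * X $ i $ j"
  for X :: "'a::comm_ring_1^'m^'n"
  by (simp add: mat_def matrix_matrix_mult_def mult_delta_left mult_delta_right)

lemma mat_mult: "mat (a * b) = (mat a ** mat b :: 'a::comm_ring_1^'n^'n)"
  unfolding vec_eq_iff mat_matrix_mult_nth by (simp add: mat_def)

lemma matrix_mult_mat_nth: "(X ** mat a) $ i $ j = a * X $ i $ j"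
  for X :: "'a::comm_ring_1^'m^'n"
  by (simp add: mat_def matrix_matrix_mult_def mult_delta_left mult_delta_right mult.commute)

lemma mat_commute: "mat a ** X = X ** mat a"
  for X :: "'a::comm_ring_1^'m^'n"
  by (simp add: vec_eq_iff mat_matrix_mult_nth matrix_mult_mat_nth)

lemma mat_vector_mult: "mat a *v x = a *s x"
  for x :: "'a::comm_ring_1^'n"
  by (simp add: vec_eq_iff mat_def matrix_vector_mult_def mult_delta_left mult_delta_right)

lemma vector_mult_mat: "x v* mat a = a *s x"
  for x :: "'a::comm_ring_1^'n"
  by (simp add: vec_eq_iff mat_def vector_matrix_mult_def mult_delta_left mult_delta_right mult.commute)

lemma matrix_diff_distrib_right: "(X - Y) ** Z = X ** Z - Y ** Z"
  for X :: "'a::comm_ring_1^'m^'n"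
  by (simp add: vec_eq_iff matrix_matrix_mult_def left_diff_distrib sum_subtractf)

lemma matrix_diff_distrib_left: "Z ** (X - Y) = Z ** X - Z ** Y"
  for X :: "'a::comm_ring_1^'m^'n"
  by (simp add: vec_eq_iff matrix_matrix_mult_def right_diff_distrib sum_subtractf)

lemma matrix_mult_zero [simp]: "X ** 0 = 0" "0 ** Y = 0"
  for X :: "'a::comm_ring_1^'m^'n"
  by (simp_all add: vec_eq_iff matrix_matrix_mult_def)

text \<open>Horner evaluation of a polynomial at a square matrix.\<close>

definition matrix_poly :: "'a::comm_ring_1^'n^'n \<Rightarrow> 'a poly \<Rightarrow> 'a^'n^'n" where
  "matrix_poly M p = fold_coeffs (\<lambda>a X. mat a + M ** X) p 0"

lemma matrix_poly_0 [simp]: "matrix_poly M 0 = 0"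
  by (simp add: matrix_poly_def)

lemma matrix_poly_pCons [simp]: "matrix_poly M (pCons a p) = mat a + M ** matrix_poly M p"
  by (cases "p = 0 \<and> a = 0") (auto simp: matrix_poly_def)

lemma matrix_poly_add: "matrix_poly M (p + q) = matrix_poly M p + matrix_poly M q"
  by (induction p q rule: poly_induct2) (simp_all add: mat_add matrix_add_ldistrib algebra_simps)

lemma matrix_poly_smult: "matrix_poly M (smult c p) = mat c ** matrix_poly M p"
proof (induction p)
  case (pCons a p)
  then show ?case
    by (simp add: mat_mult matrix_add_ldistrib matrix_mul_assoc mat_commute[of c M])
qed simp

lemma matrix_poly_linear_factor_mult:
  "matrix_poly M ([:-a, 1:] * q) = (M - mat a) ** matrix_poly M q"
proof -
  have "[:-a, 1:] * q = smult (-a) q + pCons 0 q"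
    by simp
  also have "matrix_poly M \<dots> = mat (-a) ** matrix_poly M q + M ** matrix_poly M q"
    by (simp only: matrix_poly_add matrix_poly_smult matrix_poly_pCons mat_0 add_0)
  also have "mat (-a) ** matrix_poly M q = - (mat a ** matrix_poly M q)"
    by (simp add: vec_eq_iff mat_matrix_mult_nth)
  finally show ?thesis
    by (simp add: matrix_diff_distrib_right)
qed

lemma matrix_poly_monom: "matrix_poly M (monom a k) = mat a ** (((**) M ^^ k) (mat 1))"
proof (induction k)
  case (Suc k)
  have "matrix_poly M (monom a (Suc k)) = M ** matrix_poly M (monom a k)"
    by (simp add: monom_Suc)
  also have "\<dots> = mat a ** (M ** ((**) M ^^ k) (mat 1))"
    by (simp add: Suc.IH matrix_mul_assoc mat_commute[of a M])
  finally show ?case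
    by simp
qed (simp add: monom_0)

lemma matrix_poly_sum: "matrix_poly M (sum f T) = (\<Sum>i\<in>T. matrix_poly M (f i))"
  by (induction T rule: infinite_finite_induct) (simp_all add: matrix_poly_add)

text \<open>The powers of \<open>M\<close> all live in one finite-dimensional real space, so they satisfy a
  linear relation. If two powers coincide, the relation is read off directly; otherwise the
  infinitely many powers are linearly dependent.\<close>

lemma ex_annihilating_poly:
  fixes M :: "complex^'n^'n"
  shows "\<exists>p. p \<noteq> 0 \<and> matrix_poly M p = 0"
proof -
  define pw where "pw k = ((**) M ^^ k) (mat 1)" for k
  show ?thesis
  proof (cases "inj pw")
    case False
    then obtain i j where ij: "i \<noteq> j" "pw i = pw j"
      by (auto simp: inj_on_def)
    have "matrix_poly M (monom 1 i + monom (-1) j) = 0"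
      using ij by (auto simp: matrix_poly_add matrix_poly_monom vec_eq_iff mat_matrix_mult_nth
          simp flip: pw_def)
    moreover have "coeff (monom 1 i + monom (-1) j :: complex poly) i = 1"
      using ij by simp
    ultimately show ?thesis
      by (metis coeff_0 zero_neq_one)
  next
    case True
    then have "infinite (range pw)"
      using finite_imageD by blast
    then have "dependent (range pw)"
      using independent_bound by blast
    then obtain T c where T: "finite T" "T \<subseteq> range pw" "(\<Sum>X\<in>T. c X *\<^sub>R X) = 0"
      and c: "\<exists>X\<in>T. c X \<noteq> 0"
      unfolding dependent_explicit by blast
    from T obtain K where K: "T = pw ` K"
      by (meson subset_imageE)
    have injK: "inj_on pw K"
      using True by (rule inj_on_subset) simp
    have finK: "finite K"
      using T(1) K injK by (simp add: finite_image_iff)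
    define p where "p = (\<Sum>k\<in>K. monom (complex_of_real (c (pw k))) k)"
    have "matrix_poly M p = (\<Sum>k\<in>K. c (pw k) *\<^sub>R pw k)"
      unfolding p_def matrix_poly_sum matrix_poly_monom pw_def[symmetric]
      by (intro sum.cong refl) (subst vec_eq_iff, simp add: vec_eq_iff mat_matrix_mult_nth, simp add: scaleR_conv_of_real)
    also have "\<dots> = 0"
      using T(3) injK by (simp add: K sum.reindex)
    finally have "matrix_poly M p = 0" .
    moreover obtain k where k: "k \<in> K" "c (pw k) \<noteq> 0"
      using c K by auto
    have "coeff p k = complex_of_real (c (pw k))"
      using k finK by (simp add: p_def coeff_sum sum.delta)
    then have "p \<noteq> 0"
      using k by auto
    ultimately show ?thesis by blast
  qed
qed

primrec factor_prod :: "'a::comm_ring_1^'n^'n \<Rightarrow> 'a list \<Rightarrow> 'a^'n^'n" where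
  "factor_prod M [] = mat 1"
| "factor_prod M (a # as) = (M - mat a) ** factor_prod M as"

lemma complex_poly_splits:
  fixes p :: "complex poly"
  assumes "p \<noteq> 0"
  shows "\<exists>c as. c \<noteq> 0 \<and> p = smult c (\<Prod>a\<leftarrow>as. [:-a, 1:])"
  using assms
proof (induction "degree p" arbitrary: p)
  case 0
  then obtain c where "p = [:c:]" "c \<noteq> 0"
    by (metis degree_eq_zeroE pCons_0_0)
  then show ?case
    by (intro exI[of _ c] exI[of _ "[]"]) auto
next
  case (Suc n)
  then have "\<not> constant (poly p)"
    by (simp add: constant_degree)
  then obtain z where "poly p z = 0"
    using fundamental_theorem_of_algebra by blast
  then obtain q where q: "p = [:-z, 1:] * q"
    by (auto simp: poly_eq_0_iff_dvd elim: dvdE)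
  with Suc.prems have "q \<noteq> 0" by auto
  then have "degree p = Suc (degree q)"
    unfolding q by (subst degree_mult_eq) auto
  then have "n = degree q"
    using Suc.hyps(2) by simp
  from Suc.hyps(1)[OF this \<open>q \<noteq> 0\<close>]
  obtain c as where "c \<noteq> 0" "q = smult c (\<Prod>a\<leftarrow>as. [:-a, 1:])"
    by blast
  then show ?case
    by (intro exI[of _ c] exI[of _ "z # as"]) (simp add: q)
qed

lemma matrix_poly_prod_linear_factors:
  "matrix_poly M (\<Prod>a\<leftarrow>as. [:-a, 1:]) = factor_prod M as"
proof (induction as)
  case (Cons a as)
  then show ?case
    by (simp only: list.map prod_list.Cons matrix_poly_linear_factor_mult factor_prod.simps)
qed (simp add: one_pCons)

lemma ex_factor_prod_eq_0:
  fixes M :: "complex^'n^'n"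
  shows "\<exists>as. factor_prod M as = 0"
proof -
  obtain p where p: "p \<noteq> 0" "matrix_poly M p = 0"
    using ex_annihilating_poly by blast
  obtain c as where c: "c \<noteq> 0" "p = smult c (\<Prod>a\<leftarrow>as. [:-a, 1:])"
    using complex_poly_splits[OF p(1)] by blast
  have "mat c ** factor_prod M as = 0"
    using p c by (simp only: matrix_poly_smult matrix_poly_prod_linear_factors)
  then have "factor_prod M as = 0"
    using c by (simp add: vec_eq_iff mat_matrix_mult_nth)
  then show ?thesis ..
qed

lemma factor_prod_append: "factor_prod M (as @ bs) = factor_prod M as ** factor_prod M bs"
  by (induction as) (simp_all add: matrix_mul_assoc)

lemma linear_factor_factor_prod_commute:
  "(M - mat b) ** factor_prod M as = factor_prod M as ** (M - mat b)"
proof (induction as)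
  case (Cons a as)
  have "(M - mat b) ** (M - mat a) = (M - mat a) ** (M - mat b)"
    by (simp add: matrix_diff_distrib_right matrix_diff_distrib_left
        mat_commute[of a M] mat_commute[of b M] mat_commute[of b "mat a"])
  then show ?case
    using Cons by (metis factor_prod.simps(2) matrix_mul_assoc)
qed simp

text \<open>In a shortest annihilating product every factor is singular: the factors commute, so any one
  of them can be moved to the front, and a nonzero column of the product of the others is then an
  eigenvector for it.\<close>

lemma ex_factor_prod_eq_0_eigenvalues:
  fixes M :: "complex^'n^'n"
  shows "\<exists>as. factor_prod M as = 0 \<and> (\<forall>a\<in>set as. \<exists>v. v \<noteq> 0 \<and> M *v v = a *s v)"
proof -
  obtain as where as: "factor_prod M as = 0"
    and minimal: "\<And>bs. factor_prod M bs = 0 \<Longrightarrow> length as \<le> length bs"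
    using ex_factor_prod_eq_0[of M] ex_has_least_nat[of "\<lambda>as. factor_prod M as = 0" _ length]
    by metis
  have "\<exists>v. v \<noteq> 0 \<and> M *v v = a *s v" if "a \<in> set as" for a
  proof -
    obtain xs ys where xy: "as = xs @ a # ys"
      using split_list[OF \<open>a \<in> set as\<close>] by blast
    define N where "N = factor_prod M (xs @ ys)"
    have "(M - mat a) ** N = factor_prod M as"
      unfolding N_def xy factor_prod_append factor_prod.simps matrix_mul_assoc
      by (simp only: linear_factor_factor_prod_commute)
    then have zero: "(M - mat a) ** N = 0"
      using as by simp
    have "N \<noteq> 0"
      using minimal[of "xs @ ys"] by (auto simp: N_def xy)
    then obtain i j where ij: "N $ i $ j \<noteq> 0"
      by (auto simp: vec_eq_iff)
    \<comment> \<open>the \<open>j\<close>-th column of \<open>N\<close>\<close>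
    define v where "v = N *v axis j 1"
    have "v $ i = N $ i $ j"
      by (simp add: v_def matrix_vector_mult_def axis_def mult_delta_right mult_delta_left)
    then have "v \<noteq> 0"
      using ij by auto
    moreover have "(M - mat a) *v v = 0"
      by (simp add: v_def matrix_vector_mul_assoc zero)
    then have "M *v v = a *s v"
      by (simp add: matrix_vector_mult_diff_rdistrib mat_vector_mult)
    ultimately show ?thesis by blast
  qed
  with as show ?thesis by blast
qed

lemma ex_eigenvalues_factor_prod_eq_0:
  "\<exists>as. factor_prod (map_matrix complex_of_real A) as = 0 \<and> set as \<subseteq> eigenvalues A"
  using ex_factor_prod_eq_0_eigenvalues[of "map_matrix complex_of_real A"]
  by (auto simp: eigenvalues_def)

section \<open>Disjoint spectra and the Sylvester equation\<close>

lemma map_matrix_of_real_mult: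
  "map_matrix complex_of_real (X ** Y) = map_matrix complex_of_real X ** map_matrix complex_of_real Y"
  by (simp add: vec_eq_iff matrix_matrix_mult_def)

lemma linear_factor_mult_eq_0_imp:
  assumes "a \<notin> eigenvalues A"
    and "(map_matrix complex_of_real A - mat a) ** X = 0"
  shows "X = 0"
proof -
  have inj: "v = 0" if "(map_matrix complex_of_real A - mat a) *v v = 0" for v
    using assms(1) that
    by (auto simp: eigenvalues_def matrix_vector_mult_diff_rdistrib mat_vector_mult)
  have "X *v v = 0" for v
    by (rule inj) (simp add: matrix_vector_mul_assoc assms(2))
  then show ?thesis
    by (simp add: matrix_eq)
qed

lemma factor_prod_mult_eq_0_imp:
  assumes "set as \<inter> eigenvalues A = {}"
    and "factor_prod (map_matrix complex_of_real A) as ** X = 0"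
  shows "X = 0"
  using assms
proof (induction as)
  case (Cons a as)
  have "(map_matrix complex_of_real A - mat a)
      ** (factor_prod (map_matrix complex_of_real A) as ** X) = 0"
    using Cons.prems(2) by (simp add: matrix_mul_assoc)
  moreover have "a \<notin> eigenvalues A" and disj: "set as \<inter> eigenvalues A = {}"
    using Cons.prems(1) by auto
  ultimately have "factor_prod (map_matrix complex_of_real A) as ** X = 0"
    using linear_factor_mult_eq_0_imp by blast
  then show ?case
    by (rule Cons.IH[OF disj])
qed simp

lemma factor_prod_intertwine:
  assumes "M ** X = X ** N"
  shows "factor_prod M as ** X = X ** factor_prod N as"
proof (induction as)
  case (Cons a as)
  have "(M - mat a) ** X = X ** (N - mat a)"
    by (simp add: matrix_diff_distrib_right matrix_diff_distrib_left mat_commute[of a X] assms)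
  then show ?case
    using Cons by (metis factor_prod.simps(2) matrix_mul_assoc)
qed simp

text \<open>An annihilating product for \<open>S\<close> moves across \<open>X\<close> and becomes a product of factors \<open>A - a\<close>
  with \<open>a\<close> an eigenvalue of \<open>S\<close>. None of these \<open>a\<close> is an eigenvalue of \<open>A\<close>, so the factors can be
  cancelled one by one.\<close>

lemma intertwiner_eq_0:
  fixes A :: "real^'n^'n" and S :: "real^'v^'v" and X :: "real^'v^'n"
  assumes disjoint: "eigenvalues A \<inter> eigenvalues S = {}"
    and eq: "A ** X = X ** S"
  shows "X = 0"
proof -
  let ?c = "map_matrix complex_of_real :: real^'v^'n \<Rightarrow> _"
  obtain as where as: "factor_prod (map_matrix complex_of_real S) as = 0"
    "set as \<subseteq> eigenvalues S"
    using ex_eigenvalues_factor_prod_eq_0 by blast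
  have "map_matrix complex_of_real A ** ?c X = ?c X ** map_matrix complex_of_real S"
    by (simp add: eq flip: map_matrix_of_real_mult)
  from factor_prod_intertwine[OF this, of as]
  have "factor_prod (map_matrix complex_of_real A) as ** ?c X = 0"
    by (simp add: as(1))
  moreover have "set as \<inter> eigenvalues A = {}"
    using as(2) disjoint by blast
  ultimately have "?c X = 0"
    by (rule factor_prod_mult_eq_0_imp[rotated])
  then show ?thesis
    by (simp add: vec_eq_iff)
qed

text \<open>The operator \<open>P \<mapsto> P S - A P\<close> on the space of matrices is injective, hence bijective.\<close>

lemma sylvester_ex1:
  fixes A :: "real^'n^'n" and S :: "real^'v^'v" and Q :: "real^'v^'n"
  assumes "eigenvalues A \<inter> eigenvalues S = {}"
  shows "\<exists>!P. A ** P + Q = P ** S"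
proof -
  define T where "T P = P ** S - A ** P" for P :: "real^'v^'n"
  have lin: "linear T"
  proof (rule linearI)
    show "T (X + Y) = T X + T Y" for X Y
      by (simp add: T_def vec_eq_iff matrix_matrix_mult_def distrib_left distrib_right sum.distrib)
    show "T (c *\<^sub>R X) = c *\<^sub>R T X" for c X
      by (simp add: T_def vec_eq_iff matrix_matrix_mult_def sum_distrib_left right_diff_distrib
          mult_ac)
  qed
  have "inj T"
    unfolding linear_injective_0[OF lin]
    using intertwiner_eq_0[OF assms] by (simp add: T_def)
  moreover from this have "surj T"
    using lin by (simp add: linear_injective_imp_surjective)
  ultimately have "\<exists>!P. T P = Q"
    by (metis injD surj_def)
  moreover have "T P = Q \<longleftrightarrow> A ** P + Q = P ** S" for P
    unfolding T_def diff_eq_eq by (metis add.commute)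
  ultimately show ?thesis
    by simp
qed

section \<open>Factored linear differential equations\<close>

text \<open>The equation \<open>(d/dt - a\<^sub>1) ... (d/dt - a\<^sub>m) f = 0\<close> on the half line. Each intermediate function
  is existentially quantified, which turns the equation of order \<open>m\<close> into a cascade of first-order
  equations and avoids iterated derivatives.\<close>

primrec solves_factored :: "complex list \<Rightarrow> (real \<Rightarrow> complex) \<Rightarrow> bool" where
  "solves_factored [] f \<longleftrightarrow> (\<forall>t\<ge>0. f t = 0)"
| "solves_factored (a # as) f \<longleftrightarrow>
     (\<exists>g. (\<forall>t\<ge>0. (f has_vector_derivative (a * f t + g t)) (at t within {0..})) \<and>
          solves_factored as g)"

text \<open>For a row vector \<open>r\<close>, differentiating \<open>r z\<close> along \<open>z' = A z\<close> multiplies \<open>r\<close> by \<open>A\<close>, so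
  \<open>d/dt - a\<close> acts on these signals as \<open>r \<mapsto> r (A - a)\<close>. Once \<open>r\<close> has passed through all factors of
  an annihilating product it is zero.\<close>

lemma factored_signal:
  fixes A :: "real^'n^'n" and z :: "real \<Rightarrow> real^'n" and r :: "complex^'n"
  assumes z: "\<And>t. t \<ge> 0 \<Longrightarrow> (z has_vector_derivative (A *v z t)) (at t within {0..})"
    and "r v* factor_prod (map_matrix complex_of_real A) as = 0"
  shows "solves_factored as (\<lambda>t. \<Sum>j\<in>UNIV. r $ j * complex_of_real (z t $ j))"
  using assms(2)
proof (induction as arbitrary: r)
  case Nil
  then show ?case by simp
next
  case (Cons a as)
  let ?M = "map_matrix complex_of_real A"
  let ?f = "\<lambda>r t. \<Sum>j\<in>UNIV. r $ j * complex_of_real (z t $ j)"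
  have deriv: "(?f r has_vector_derivative (?f (r v* ?M) t)) (at t within {0..})" if "t \<ge> 0" for t
  proof -
    have "((\<lambda>t. z t $ j) has_vector_derivative (A *v z t) $ j) (at t within {0..})" for j
      using z[OF that] bounded_linear.has_vector_derivative[OF bounded_linear_vec_nth] by blast
    then have "((\<lambda>t. complex_of_real (z t $ j)) has_vector_derivative
        complex_of_real ((A *v z t) $ j)) (at t within {0..})" for j
      using bounded_linear.has_vector_derivative[OF bounded_linear_of_real] by blast
    then have "(?f r has_vector_derivative (\<Sum>j\<in>UNIV. r $ j * complex_of_real ((A *v z t) $ j)))
        (at t within {0..})"
      by (intro has_vector_derivative_sum has_vector_derivative_mult_right)
    also have "(\<Sum>j\<in>UNIV. r $ j * complex_of_real ((A *v z t) $ j)) = ?f (r v* ?M) t"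
      unfolding matrix_vector_mult_def vector_matrix_mult_def
      by (simp add: sum_distrib_left sum_distrib_right, subst sum.swap) (simp add: mult_ac)
    finally show ?thesis .
  qed
  have "?f (r v* ?M) t = a * ?f r t + ?f (r v* (?M - mat a)) t" for t
    by (simp add: vector_matrix_mult_diff_rdistrib vector_mult_mat left_diff_distrib
        sum_subtractf sum_distrib_left mult.assoc)
  moreover have "solves_factored as (?f (r v* (?M - mat a)))"
    using Cons.prems by (intro Cons.IH) (simp add: vector_matrix_mul_assoc)
  ultimately show ?case
    using deriv by (auto intro!: exI[of _ "?f (r v* (?M - mat a))"])
qed

lemma exp_integrating_factor:
  fixes f :: "real \<Rightarrow> complex"
  assumes "(f has_vector_derivative (a * f t + g)) (at t within T)"
  shows "((\<lambda>t. exp (-(a * of_real t)) * f t) has_vector_derivative (exp (-(a * of_real t)) * g))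
    (at t within T)"
proof -
  have "((\<lambda>t. exp (-(a * of_real t))) has_vector_derivative (-a * exp (-(a * of_real t))))
      (at t within T)"
    by (rule has_vector_derivative_real_field)
      (auto intro!: derivative_eq_intros)
  from has_vector_derivative_mult[OF this assms] show ?thesis
    by (simp add: algebra_simps)
qed

text \<open>After multiplication by the integrating factor \<open>exp(-a t)\<close> the derivative is at most
  \<open>d b exp(b t)\<close> in norm for late times, where \<open>b = - Re a\<close> and \<open>d\<close> is as small as desired. This is
  the derivative of \<open>d exp(b t)\<close>, and undoing the multiplication bounds \<open>f\<close> by \<open>d\<close> plus an
  exponentially decaying term.\<close>

lemma linear_ode_tendsto_0:
  fixes f g :: "real \<Rightarrow> complex"
  assumes f: "\<And>t. t \<ge> 0 \<Longrightarrow> (f has_vector_derivative (a * f t + g t)) (at t within {0..})"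
    and g: "(g \<longlongrightarrow> 0) at_top" and a: "Re a < 0"
  shows "(f \<longlongrightarrow> 0) at_top"
proof (rule tendstoI)
  fix e :: real assume "e > 0"
  define b where "b = - Re a"
  have "b > 0" using a by (simp add: b_def)
  \<comment> \<open>half of \<open>e\<close> is kept for the transient \<open>exp (-(b * t)) * norm (?h T)\<close>\<close>
  define d where "d = e / 2"
  have "d > 0" using \<open>e > 0\<close> by (simp add: d_def)
  have "eventually (\<lambda>t. norm (g t) < d * b) at_top"
    using tendstoD[OF g, of "d * b"] \<open>d > 0\<close> \<open>b > 0\<close> by simp
  then obtain T0 where T0: "\<And>t. t \<ge> T0 \<Longrightarrow> norm (g t) < d * b"
    by (auto simp: eventually_at_top_linorder)
  define T where "T = max 0 T0"
  let ?h = "\<lambda>t. exp (-(a * of_real t)) * f t"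
  have bound: "norm (f t) \<le> d + exp (-(b * t)) * norm (?h T)" if "t > T" for t
  proof -
    have "norm (?h t - ?h T) \<le> d * exp (b * t) - d * exp (b * T)"
    proof (rule differentiable_bound_general[where f' = "\<lambda>s. exp (-(a * of_real s)) * g s"
          and \<phi>' = "\<lambda>s. d * (b * exp (b * s))"])
      show "T < t" by fact
      have h': "(?h has_vector_derivative (exp (-(a * of_real s)) * g s)) (at s within {0..})"
        if "s \<ge> 0" for s
        by (rule exp_integrating_factor) (rule f[OF that])
      show "continuous_on {T..t} ?h"
      proof (rule continuous_on_vector_derivative)
        fix s assume "s \<in> {T..t}"
        then show "(?h has_vector_derivative (exp (-(a * of_real s)) * g s)) (at s within {T..t})"
          by (intro has_vector_derivative_within_subset[OF h']) (auto simp: T_def)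
      qed
      show "(?h has_vector_derivative (exp (-(a * of_real s)) * g s)) (at s)"
        if "T < s" "s < t" for s
      proof -
        have "at s within {0..} = at s"
          using that by (intro at_within_interior) (auto simp: T_def)
        then show ?thesis using h'[of s] that by (auto simp: T_def)
      qed
      show "((\<lambda>s. d * exp (b * s)) has_vector_derivative (d * (b * exp (b * s)))) (at s)" for s
        unfolding has_real_derivative_iff_has_vector_derivative[symmetric]
        by (auto intro!: derivative_eq_intros)
      show "norm (exp (-(a * of_real s)) * g s) \<le> d * (b * exp (b * s))" if "T < s" "s < t" for s
      proof -
        have "norm (g s) \<le> d * b" using T0[of s] that by (simp add: T_def)
        then have "exp (b * s) * norm (g s) \<le> exp (b * s) * (d * b)"
          by (intro mult_left_mono) auto
        then show ?thesis by (simp add: norm_mult b_def mult_ac)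
      qed
    qed (auto intro!: continuous_intros)
    also have "\<dots> \<le> d * exp (b * t)"
      using \<open>d > 0\<close> by simp
    finally have "norm (?h t) \<le> d * exp (b * t) + norm (?h T)"
      using norm_triangle_sub[of "?h t" "?h T"] by linarith
    moreover have "norm (?h t) = exp (b * t) * norm (f t)"
      by (simp add: norm_mult b_def)
    ultimately have "exp (-(b * t)) * (exp (b * t) * norm (f t))
        \<le> exp (-(b * t)) * (d * exp (b * t) + norm (?h T))"
      by (intro mult_left_mono) auto
    then show ?thesis
      by (simp add: algebra_simps flip: exp_add mult.assoc)
  qed
  have "((\<lambda>t. d + exp (-(b * t)) * norm (?h T)) \<longlongrightarrow> d + 0 * norm (?h T)) at_top"
  proof (intro tendsto_intros)
    have "filterlim (\<lambda>t. - (b * t)) at_bot at_top"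
      using \<open>b > 0\<close> by (intro filterlim_uminus_at_bot_at_top[THEN filterlim_compose]
          filterlim_tendsto_pos_mult_at_top[OF tendsto_const] filterlim_ident)
    then show "((\<lambda>t. exp (-(b * t))) \<longlongrightarrow> 0) at_top"
      using exp_at_bot filterlim_compose by blast
  qed
  then have "eventually (\<lambda>t. d + exp (-(b * t)) * norm (?h T) < e) at_top"
    by (rule order_tendstoD(2)) (use \<open>e > 0\<close> in \<open>simp add: d_def\<close>)
  with eventually_gt_at_top[of T] show "eventually (\<lambda>t. dist (f t) 0 < e) at_top"
    by eventually_elim (use bound in force)
qed

lemma solves_factored_tendsto_0:
  assumes "solves_factored as f" and "\<forall>a\<in>set as. Re a < 0"
  shows "(f \<longlongrightarrow> 0) at_top"
  using assms
proof (induction as arbitrary: f)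
  case Nil
  then have "eventually (\<lambda>t. f t = 0) at_top"
    by (auto simp: eventually_at_top_linorder)
  then show ?case by (rule tendsto_eventually)
next
  case (Cons a as)
  then obtain g
    where f: "\<And>t. t \<ge> 0 \<Longrightarrow> (f has_vector_derivative (a * f t + g t)) (at t within {0..})"
      and g: "solves_factored as g"
    by auto
  have "(g \<longlongrightarrow> 0) at_top"
    using g Cons.prems(2) by (intro Cons.IH) auto
  then show ?case
    using Cons.prems(2) by (intro linear_ode_tendsto_0[OF f]) auto
qed

lemma homogeneous_ode_shift:
  fixes f :: "real \<Rightarrow> complex"
  assumes f: "\<And>t. t \<ge> 0 \<Longrightarrow> (f has_vector_derivative (a * f t)) (at t within {0..})"
    and "t \<ge> 0" "h \<ge> 0"
  shows "f (t + h) = exp (a * of_real h) * f t"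
proof -
  have "\<exists>c. \<forall>t\<in>{0..}. exp (-(a * of_real t)) * f t = c"
  proof (rule has_vector_derivative_zero_constant)
    fix t :: real assume "t \<in> {0..}"
    then show "((\<lambda>t. exp (-(a * of_real t)) * f t) has_vector_derivative 0) (at t within {0..})"
      using exp_integrating_factor[of f a t 0] f[of t] by simp
  qed auto
  then obtain c where c: "\<And>t. t \<ge> 0 \<Longrightarrow> exp (-(a * of_real t)) * f t = c"
    by auto
  have "f t = exp (a * of_real t) * c" if "t \<ge> 0" for t
    using c[OF that] by (auto simp: exp_minus field_simps)
  then show ?thesis
    using assms by (simp add: algebra_simps exp_add)
qed

text \<open>The difference operator with parameters \<open>a\<close> and \<open>h\<close> commutes with every \<open>d/dt - b\<close> and
  annihilates the solutions of the innermost equation \<open>g' = a g\<close>. Applied to the whole cascade it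
  therefore makes the last stage superfluous. Unlike \<open>d/dt - a\<close>, it evidently preserves
  convergence to zero.\<close>

lemma solves_factored_difference:
  assumes "solves_factored (as @ [a]) f" and h: "h \<ge> 0"
  shows "solves_factored as (\<lambda>t. f (t + h) - exp (a * of_real h) * f t)"
  using assms(1)
proof (induction as arbitrary: f)
  case Nil
  then obtain g
    where f: "\<And>t. t \<ge> 0 \<Longrightarrow> (f has_vector_derivative (a * f t + g t)) (at t within {0..})"
      and g: "\<And>t. t \<ge> 0 \<Longrightarrow> g t = 0"
    by auto
  have "(f has_vector_derivative (a * f t)) (at t within {0..})" if "t \<ge> 0" for t
    using f[OF that] g[OF that] by simp
  from homogeneous_ode_shift[OF this _ h] show ?case
    by simp
next
  case (Cons b as)
  then obtain g where f: "\<And>t. t \<ge> 0 \<Longrightarrow> (f has_vector_derivative (b * f t + g t)) (at t within {0..})"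
    and g: "solves_factored (as @ [a]) g"
    by auto
  have "((\<lambda>t. f (t + h)) has_vector_derivative (b * f (t + h) + g (t + h))) (at t within {0..})"
    if "t \<ge> 0" for t
  proof -
    have "((\<lambda>t. t + h) has_vector_derivative 1) (at t within {0..})"
      by (auto intro!: derivative_eq_intros)
    moreover have "(f has_vector_derivative (b * f (t + h) + g (t + h)))
        (at (t + h) within (\<lambda>t. t + h) ` {0..})"
      using that h by (intro has_vector_derivative_within_subset[OF f]) auto
    ultimately show ?thesis
      using vector_diff_chain_within[of "\<lambda>t. t + h" 1 t "{0..}" f] by (simp add: o_def)
  qed
  then have "((\<lambda>t. f (t + h) - exp (a * of_real h) * f t) has_vector_derivative
      (b * f (t + h) + g (t + h) - exp (a * of_real h) * (b * f t + g t))) (at t within {0..})"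
    if "t \<ge> 0" for t
    using that f[OF that] by (intro has_vector_derivative_diff has_vector_derivative_mult_right) simp_all
  moreover have "b * f (t + h) + g (t + h) - exp (a * of_real h) * (b * f t + g t) =
      b * (f (t + h) - exp (a * of_real h) * f t) + (g (t + h) - exp (a * of_real h) * g t)" for t
    by (simp add: algebra_simps)
  ultimately have "((\<lambda>t. f (t + h) - exp (a * of_real h) * f t) has_vector_derivative
      b * (f (t + h) - exp (a * of_real h) * f t) + (g (t + h) - exp (a * of_real h) * g t))
      (at t within {0..})" if "t \<ge> 0" for t
    using that by simp
  with Cons.IH[OF g] show ?case
    by (auto intro: exI[of _ "\<lambda>t. g (t + h) - exp (a * of_real h) * g t"])
qed

text \<open>By induction all differences \<open>f(t + h) - exp(a h) f(t)\<close> are zero. As \<open>exp(a h)\<close> has modulus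
  one for imaginary \<open>a\<close>, the modulus of \<open>f\<close> is constant and must equal its limit.\<close>

lemma solves_factored_imaginary_tendsto_0_imp:
  assumes "solves_factored as f" and "\<forall>a\<in>set as. Re a = 0"
    and "(f \<longlongrightarrow> 0) at_top" and "t \<ge> 0"
  shows "f t = 0"
  using assms
proof (induction as arbitrary: f t rule: rev_induct)
  case (snoc a as)
  have norm_shift: "norm (f (t + h)) = norm (f t)" if "h \<ge> 0" for h
  proof -
    have "((\<lambda>t. f (t + h)) \<longlongrightarrow> 0) at_top"
      by (rule filterlim_compose[OF snoc.prems(3)], subst add.commute)
        (rule filterlim_tendsto_add_at_top[OF tendsto_const filterlim_ident])
    then have "((\<lambda>t. f (t + h) - exp (a * of_real h) * f t) \<longlongrightarrow> 0 - exp (a * of_real h) * 0) at_top"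
      by (intro tendsto_diff tendsto_mult tendsto_const snoc.prems(3))
    then have lim: "((\<lambda>t. f (t + h) - exp (a * of_real h) * f t) \<longlongrightarrow> 0) at_top"
      by simp
    have imag: "\<forall>a\<in>set as. Re a = 0"
      using snoc.prems(2) by simp
    have "f (t + h) - exp (a * of_real h) * f t = 0"
      by (rule snoc.IH[OF solves_factored_difference[OF snoc.prems(1) that] imag lim snoc.prems(4)])
    then have "norm (f (t + h)) = norm (exp (a * of_real h)) * norm (f t)"
      by (simp add: norm_mult)
    then show ?thesis
      using snoc.prems(2) by simp
  qed
  have "((\<lambda>s. norm (f s)) \<longlongrightarrow> 0) at_top"
    using snoc.prems(3) by (rule tendsto_norm_zero)
  moreover have "eventually (\<lambda>s. norm (f s) = norm (f t)) at_top"
    using eventually_ge_at_top[of t]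
  proof (rule eventually_mono)
    show "norm (f s) = norm (f t)" if "t \<le> s" for s
      using norm_shift[of "s - t"] that by simp
  qed
  ultimately have "((\<lambda>s. norm (f t)) \<longlongrightarrow> 0) (at_top :: real filter)"
    by (rule Lim_transform_eventually)
  then show ?case
    by (simp add: tendsto_const_iff)
qed simp

section \<open>Stable and persistent autonomous systems\<close>

lemma stable_trajectory_tendsto_0:
  fixes A :: "real^'n^'n" and z :: "real \<Rightarrow> real^'n"
  assumes "eigenvalues A \<subseteq> open_left_half_plane"
    and z: "\<And>t. t \<ge> 0 \<Longrightarrow> (z has_vector_derivative (A *v z t)) (at t within {0..})"
  shows "(z \<longlongrightarrow> 0) at_top"
proof -
  obtain as where as: "factor_prod (map_matrix complex_of_real A) as = 0"
    "set as \<subseteq> eigenvalues A"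
    using ex_eigenvalues_factor_prod_eq_0 by blast
  have "((\<lambda>t. z t $ i) \<longlongrightarrow> 0) at_top" for i
  proof -
    have "solves_factored as (\<lambda>t. \<Sum>j\<in>UNIV. axis i 1 $ j * complex_of_real (z t $ j))"
      by (rule factored_signal[OF z]) (simp_all add: as)
    also have "(\<lambda>t. \<Sum>j\<in>UNIV. axis i 1 $ j * complex_of_real (z t $ j))
        = (\<lambda>t. complex_of_real (z t $ i))"
      by (simp add: axis_def mult_delta_left mult_delta_right)
    finally have "((\<lambda>t. complex_of_real (z t $ i)) \<longlongrightarrow> 0) at_top"
      using as(2) assms(1) by (intro solves_factored_tendsto_0) (auto simp: open_left_half_plane_def)
    from tendsto_Re[OF this] show ?thesis
      by simp
  qed
  then show ?thesis
    by (intro vec_tendstoI) simp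
qed

lemma persistent_output_tendsto_0_imp:
  fixes S :: "real^'v^'v" and w :: "real \<Rightarrow> real^'v" and d :: "real^'v"
  assumes "eigenvalues S \<subseteq> imaginary_axis"
    and w: "\<And>t. t \<ge> 0 \<Longrightarrow> (w has_vector_derivative (S *v w t)) (at t within {0..})"
    and lim: "((\<lambda>t. d \<bullet> w t) \<longlongrightarrow> 0) at_top" and "t \<ge> 0"
  shows "d \<bullet> w t = 0"
proof -
  obtain as where as: "factor_prod (map_matrix complex_of_real S) as = 0"
    "set as \<subseteq> eigenvalues S"
    using ex_eigenvalues_factor_prod_eq_0 by blast
  have "solves_factored as
      (\<lambda>t. \<Sum>j\<in>UNIV. (\<chi> j. complex_of_real (d $ j)) $ j * complex_of_real (w t $ j))"
    by (rule factored_signal[OF w]) (simp_all add: as)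
  then have "solves_factored as (\<lambda>t. complex_of_real (d \<bullet> w t))"
    by (simp add: inner_vec_def)
  moreover have "((\<lambda>t. complex_of_real (d \<bullet> w t)) \<longlongrightarrow> 0) at_top"
    using tendsto_of_real[OF lim, where 'a = complex] by simp
  ultimately have "complex_of_real (d \<bullet> w t) = 0"
    using as(2) assms(1) \<open>t \<ge> 0\<close>
    by (intro solves_factored_imaginary_tendsto_0_imp) (auto simp: imaginary_axis_def)
  then show ?thesis by simp
qed

text \<open>Differentiating the identity \<open>d w = 0\<close> repeatedly gives \<open>d S\<^sup>k w = 0\<close> for all \<open>k\<close>. At time
  zero, reachability makes \<open>d\<close> orthogonal to the whole space, in particular to itself.\<close>

lemma zero_output_imp_zero:
  fixes S :: "real^'v^'v" and w :: "real \<Rightarrow> real^'v" and d :: "real^'v"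
  assumes w: "\<And>t. t \<ge> 0 \<Longrightarrow> (w has_vector_derivative (S *v w t)) (at t within {0..})"
    and "reachable S (w 0)" and zero: "\<And>t. t \<ge> 0 \<Longrightarrow> d \<bullet> w t = 0"
  shows "d = 0"
proof -
  have *: "(((*v) S ^^ k) (w t)) \<bullet> d = 0" if "t \<ge> 0" for k t
    using that
  proof (induction k arbitrary: t)
    case 0
    then show ?case
      using zero by (simp add: inner_commute)
  next
    case (Suc k)
    have "bounded_linear (\<lambda>v. (((*v) S ^^ k) v) \<bullet> d)"
    proof -
      have "linear ((*v) S ^^ k)"
      proof (induction k)
        case 0
        then show ?case by (simp add: linear_id[unfolded id_def])
      next
        case (Suc k)
        then show ?case
          using linear_compose[OF Suc.IH matrix_vector_mul_linear[of S]] by (simp add: o_def)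
      qed
      then show ?thesis
        by (intro bounded_linear_inner_left_comp linear_conv_bounded_linear[THEN iffD1])
    qed
    from bounded_linear.has_vector_derivative[OF this w[OF Suc.prems]]
    have "((\<lambda>t. (((*v) S ^^ k) (w t)) \<bullet> d) has_vector_derivative
        (((*v) S ^^ k) (S *v w t)) \<bullet> d) (at t within {0..})" .
    moreover have "((\<lambda>t. (((*v) S ^^ k) (w t)) \<bullet> d) has_vector_derivative 0) (at t within {0..})"
      using Suc by (intro has_vector_derivative_transform[OF _ _ has_vector_derivative_const]) auto
    moreover have "at t within {0..} \<noteq> bot"
    proof -
      have "{t<..} \<subseteq> {0..}" using Suc.prems by auto
      from at_le[OF this, of t] show ?thesis
        using trivial_limit_at_right_real[of t] by (auto simp: bot_unique)
    qed
    ultimately show ?case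
      using vector_derivative_unique_within by (fastforce simp: funpow_swap1)
  qed
  have "span ((\<lambda>k. ((*v) S ^^ k) (w 0)) ` {..<CARD('v)}) \<subseteq> {v. v \<bullet> d = 0}"
  proof (rule span_minimal)
    show "(\<lambda>k. ((*v) S ^^ k) (w 0)) ` {..<CARD('v)} \<subseteq> {v. v \<bullet> d = 0}"
      using *[of 0] by auto
    show "subspace {v. v \<bullet> d = 0}"
      by (simp add: subspace_def inner_add_left)
  qed
  then have "d \<in> {v. v \<bullet> d = 0}"
    using assms(2) unfolding reachable_def by blast
  then show ?thesis by simp
qed

section \<open>Asymptotic tracking\<close>

theorem theorem3:
  fixes A :: "real^'n^'n" and B :: "real^1^'n" and C :: "real^'n^1"
    and S :: "real^'v^'v" and L :: "real^'v^1"
    and x :: "real \<Rightarrow> real^'n" and w :: "real \<Rightarrow> real^'v"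
    and u y \<theta> \<epsilon> :: "real \<Rightarrow> real^1"
  assumes "minimal_system A B C"
    and "eigenvalues A \<subseteq> open_left_half_plane"
    and "CARD('v) \<le> CARD('n)"
    and "w 0 \<noteq> 0"
    and "minimal_generator L S (w 0)"
    and "eigenvalues S \<subseteq> imaginary_axis"
    and "eigenvalues A \<inter> eigenvalues S = {}"
    and "generator_trajectory S L w \<theta>"
    and "\<forall>t\<ge>0. u t = \<theta> t"
    and "system_trajectory A B C u x y"
    and "\<forall>t\<ge>0. \<epsilon> t = y t - \<theta> t"
  shows "(\<exists>!P::real^'v^'n. A ** P + B ** L = P ** S) \<and>
         ((\<epsilon> \<longlongrightarrow> 0) at_top \<longleftrightarrow>
            L = C ** (THE P::real^'v^'n. A ** P + B ** L = P ** S))"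
proof -
  have ex1: "\<exists>!P::real^'v^'n. A ** P + B ** L = P ** S"
    by (rule sylvester_ex1) fact
  define P :: "real^'v^'n" where "P = (THE P. A ** P + B ** L = P ** S)"
  have P: "A ** P + B ** L = P ** S"
    unfolding P_def by (rule theI'[OF ex1])
  have w: "(w has_vector_derivative (S *v w t)) (at t within {0..})"
    and \<theta>: "\<theta> t = L *v w t" if "t \<ge> 0" for t
    using assms(8) that by (auto simp: generator_trajectory_def)
  have x: "(x has_vector_derivative (A *v x t + B *v (L *v w t))) (at t within {0..})"
    and y: "y t = C *v x t" if "t \<ge> 0" for t
    using assms(9,10) that \<theta> by (auto simp: system_trajectory_def)
  \<comment> \<open>deviation from the steady state \<open>P *v w t\<close>; the Sylvester equation cancels the input\<close>
  define z where "z t = x t - P *v w t" for t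
  have "(z has_vector_derivative (A *v z t)) (at t within {0..})" if "t \<ge> 0" for t
  proof -
    have "((\<lambda>t. P *v w t) has_vector_derivative (P *v (S *v w t))) (at t within {0..})"
      using w[OF that] matrix_vector_mul_bounded_linear bounded_linear.has_vector_derivative by blast
    from has_vector_derivative_diff[OF x[OF that] this]
    have "(z has_vector_derivative (A *v x t + B *v (L *v w t) - P *v (S *v w t)))
        (at t within {0..})"
      by (simp add: z_def[abs_def])
    also have "P *v (S *v w t) = A *v (P *v w t) + B *v (L *v w t)"
      by (simp add: matrix_vector_mul_assoc matrix_vector_mult_add_rdistrib flip: P)
    also have "A *v x t + B *v (L *v w t) - \<dots> = A *v z t"
      by (simp add: z_def matrix_vector_mult_diff_distrib)
    finally show ?thesis .
  qed
  then have z0: "(z \<longlongrightarrow> 0) at_top"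
    by (rule stable_trajectory_tendsto_0[OF assms(2)])
  have Cz0: "((\<lambda>t. C *v z t) \<longlongrightarrow> 0) at_top"
    using bounded_linear.tendsto_zero[OF matrix_vector_mul_bounded_linear z0] .
  define D where "D = C ** P - L"
  have \<epsilon>: "\<epsilon> t = C *v z t + D *v w t" if "t \<ge> 0" for t
    using that assms(11) y \<theta>
    by (simp add: z_def D_def matrix_vector_mult_diff_distrib matrix_vector_mult_diff_rdistrib
        matrix_vector_mul_assoc)
  have "eventually (\<lambda>t. \<epsilon> t = C *v z t + D *v w t) at_top"
    using eventually_ge_at_top[of 0] by (rule eventually_mono) (rule \<epsilon>)
  then have "(\<epsilon> \<longlongrightarrow> 0) at_top \<longleftrightarrow> ((\<lambda>t. C *v z t + D *v w t) \<longlongrightarrow> 0) at_top"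
    by (rule tendsto_cong)
  also have "\<dots> \<longleftrightarrow> ((\<lambda>t. D *v w t) \<longlongrightarrow> 0) at_top"
  proof
    assume "((\<lambda>t. C *v z t + D *v w t) \<longlongrightarrow> 0) at_top"
    from tendsto_diff[OF this Cz0] show "((\<lambda>t. D *v w t) \<longlongrightarrow> 0) at_top"
      unfolding add_diff_cancel_left' diff_0_right .
  next
    assume "((\<lambda>t. D *v w t) \<longlongrightarrow> 0) at_top"
    from tendsto_add[OF Cz0 this] show "((\<lambda>t. C *v z t + D *v w t) \<longlongrightarrow> 0) at_top"
      unfolding add_0_left .
  qed
  also have "\<dots> \<longleftrightarrow> D = 0"
  proof
    assume "((\<lambda>t. D *v w t) \<longlongrightarrow> 0) at_top"
    from tendsto_vec_nth[OF this, of 1] have "((\<lambda>t. D $ 1 \<bullet> w t) \<longlongrightarrow> 0) at_top"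
      unfolding matrix_vector_mul_component zero_index .
    then have "D $ 1 \<bullet> w t = 0" if "t \<ge> 0" for t
      using persistent_output_tendsto_0_imp[OF assms(6) w] that by blast
    then have "D $ 1 = 0"
      using zero_output_imp_zero[OF w] assms(5) by (auto simp: minimal_generator_def)
    then show "D = 0"
      by (simp add: vec_eq_iff)
  qed simp
  also have "\<dots> \<longleftrightarrow> L = C ** P"
    by (auto simp: D_def)
  finally show ?thesis
    unfolding P_def by (rule conjI[OF ex1])
qed

end
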